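(* Let $\Gamma$ be an infinite, locally finite, connected, unweighted graph which is quasi-transitive. If $\bar\lambda(\Gamma)=2$, then $\Gamma$ is bipartite.
   Context: Unweighted means $\mu_{xy}=1$ if $x\sim y$ and $\mu_{xy}=0$ otherwise; the general setting permits self-loops ($x\sim x$). $\mathrm{Aut}(\Gamma)$ is the group of all self-isometries of the vertex set $V$ with the graph distance; $\Gamma$ is quasi-transitive if $V$ has only finitely many orbits under $\mathrm{Aut}(\Gamma)$. With $d_x=\sum_y\mu_{xy}$ the degree of the vertex $x$, the normalized Laplace operator is the bounded self-adjoint operator on the space of $f:V\to\mathbb R$ with $\sum_x d_xf(x)^2<\infty$ (inner product $\sum_xd_xf(x)g(x)$) given by $\Delta f(x)=f(x)-\frac1{d_x}\sum_{y}\mu_{xy}f(y)$, and $\bar\lambda(\Gamma)=\sup\sigma(\Delta)$ is the top of its spectrum.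
   Formalization: Aut(Γ) consists of the self-isometries that also preserve self-loops (automatic for loopless graphs); with all self-isometries the claim fails for the integer line with one self-loop added at 0. *)

theory Defs
  imports "HOL-Analysis.Analysis"
begin

text \<open>
  A weighted graph is given by its edge weights \<open>\<mu> :: 'v \<Rightarrow> 'v \<Rightarrow> real\<close>; the vertex set is the whole
  type \<open>'v\<close>. Two vertices are adjacent when their weight is positive, and \<open>adj \<mu> x x\<close> (a
  self-loop) is not excluded.
\<close>

definition weighted_graph :: "('v \<Rightarrow> 'v \<Rightarrow> real) \<Rightarrow> bool" where
  "weighted_graph \<mu> \<longleftrightarrow> (\<forall>x y. \<mu> x y = \<mu> y x) \<and> (\<forall>x y. 0 \<le> \<mu> x y)"

definition adj :: "('v \<Rightarrow> 'v \<Rightarrow> real) \<Rightarrow> 'v \<Rightarrow> 'v \<Rightarrow> bool" where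
  "adj \<mu> x y \<longleftrightarrow> 0 < \<mu> x y"

definition unweighted :: "('v \<Rightarrow> 'v \<Rightarrow> real) \<Rightarrow> bool" where
  "unweighted \<mu> \<longleftrightarrow> (\<forall>x y. \<mu> x y = (if adj \<mu> x y then 1 else 0))"

definition locally_finite_graph :: "('v \<Rightarrow> 'v \<Rightarrow> real) \<Rightarrow> bool" where
  "locally_finite_graph \<mu> \<longleftrightarrow> (\<forall>x. finite {y. adj \<mu> x y})"

definition connected_graph :: "('v \<Rightarrow> 'v \<Rightarrow> real) \<Rightarrow> bool" where
  "connected_graph \<mu> \<longleftrightarrow> (\<forall>x y. (adj \<mu>)\<^sup>*\<^sup>* x y)"

text \<open>Bipartiteness excludes self-loops, which are cycles of length one.\<close>

definition bipartite_graph :: "('v \<Rightarrow> 'v \<Rightarrow> real) \<Rightarrow> bool" where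
  "bipartite_graph \<mu> \<longleftrightarrow>
     (\<exists>V1 V2. V1 \<union> V2 = UNIV \<and> V1 \<inter> V2 = {} \<and>
        (\<forall>x y. adj \<mu> x y \<longrightarrow> (x \<in> V1 \<and> y \<in> V2) \<or> (x \<in> V2 \<and> y \<in> V1)))"

text \<open>The \<open>n\<close>-th relational power of adjacency relates the end points of walks with \<open>n\<close> edges.\<close>

definition graph_dist :: "('v \<Rightarrow> 'v \<Rightarrow> real) \<Rightarrow> 'v \<Rightarrow> 'v \<Rightarrow> nat" where
  "graph_dist \<mu> x y = (LEAST n. (adj \<mu> ^^ n) x y)"

definition self_isometry :: "('v \<Rightarrow> 'v \<Rightarrow> real) \<Rightarrow> ('v \<Rightarrow> 'v) \<Rightarrow> bool" where
  "self_isometry \<mu> \<phi> \<longleftrightarrow>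
     bij \<phi> \<and> (\<forall>x y. graph_dist \<mu> (\<phi> x) (\<phi> y) = graph_dist \<mu> x y)"

text \<open>
  The graph distance does not see self-loops, so an isometry need not be a graph automorphism
  when there are any; automorphisms are therefore required to respect self-loops as well. For
  graphs without self-loops the extra condition is void, and the automorphisms are exactly the
  self-isometries. It cannot be dropped otherwise: the integer line with one self-loop added at
  \<open>0\<close> has transitive isometry group and \<open>2\<close> as top of its spectrum, but is not bipartite.
\<close>

definition graph_Aut :: "('v \<Rightarrow> 'v \<Rightarrow> real) \<Rightarrow> ('v \<Rightarrow> 'v) set" where
  "graph_Aut \<mu> = {\<phi>. self_isometry \<mu> \<phi> \<and> (\<forall>x. adj \<mu> (\<phi> x) (\<phi> x) \<longleftrightarrow> adj \<mu> x x)}"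

lemma graph_Aut_eq_self_isometries:
  assumes "\<And>x. \<not> adj \<mu> x x"
  shows "graph_Aut \<mu> = {\<phi>. self_isometry \<mu> \<phi>}"
  using assms by (simp add: graph_Aut_def)

definition Aut_orbit :: "('v \<Rightarrow> 'v \<Rightarrow> real) \<Rightarrow> 'v \<Rightarrow> 'v set" where
  "Aut_orbit \<mu> x = (\<lambda>\<phi>. \<phi> x) ` graph_Aut \<mu>"

definition quasi_transitive :: "('v \<Rightarrow> 'v \<Rightarrow> real) \<Rightarrow> bool" where
  "quasi_transitive \<mu> \<longleftrightarrow> finite (range (Aut_orbit \<mu>))"

definition degree :: "('v \<Rightarrow> 'v \<Rightarrow> real) \<Rightarrow> 'v \<Rightarrow> real" where
  "degree \<mu> x = (\<Sum>\<^sub>\<infinity>y. \<mu> x y)"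

text \<open>
  The real Hilbert space of functions square-summable with respect to the degree. It is kept as a
  set of functions; when every vertex has positive degree, \<open>l2_norm \<mu> f = 0\<close> means \<open>f = 0\<close> there, so
  no quotient is needed.
\<close>

definition l2_space :: "('v \<Rightarrow> 'v \<Rightarrow> real) \<Rightarrow> ('v \<Rightarrow> real) set" where
  "l2_space \<mu> = {f. (\<lambda>x. degree \<mu> x * (f x)\<^sup>2) summable_on UNIV}"

definition l2_inner :: "('v \<Rightarrow> 'v \<Rightarrow> real) \<Rightarrow> ('v \<Rightarrow> real) \<Rightarrow> ('v \<Rightarrow> real) \<Rightarrow> real" where
  "l2_inner \<mu> f g = (\<Sum>\<^sub>\<infinity>x. degree \<mu> x * f x * g x)"

definition l2_norm :: "('v \<Rightarrow> 'v \<Rightarrow> real) \<Rightarrow> ('v \<Rightarrow> real) \<Rightarrow> real" where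
  "l2_norm \<mu> f = sqrt (l2_inner \<mu> f f)"

definition l2_bounded_op ::
    "('v \<Rightarrow> 'v \<Rightarrow> real) \<Rightarrow> (('v \<Rightarrow> real) \<Rightarrow> ('v \<Rightarrow> real)) \<Rightarrow> bool" where
  "l2_bounded_op \<mu> T \<longleftrightarrow>
     (\<forall>f\<in>l2_space \<mu>. T f \<in> l2_space \<mu>) \<and>
     (\<forall>f\<in>l2_space \<mu>. \<forall>g\<in>l2_space \<mu>. T (\<lambda>x. f x + g x) = (\<lambda>x. T f x + T g x)) \<and>
     (\<forall>c. \<forall>f\<in>l2_space \<mu>. T (\<lambda>x. c * f x) = (\<lambda>x. c * T f x)) \<and>
     (\<exists>C. \<forall>f\<in>l2_space \<mu>. l2_norm \<mu> (T f) \<le> C * l2_norm \<mu> f)"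

text \<open>
  The values \<open>c\<close> for which \<open>T - c\<close> has no bounded inverse. Only real \<open>c\<close> are considered; for a
  self-adjoint \<open>T\<close> this is the full spectrum of the complexification.
\<close>

definition l2_spectrum ::
    "('v \<Rightarrow> 'v \<Rightarrow> real) \<Rightarrow> (('v \<Rightarrow> real) \<Rightarrow> ('v \<Rightarrow> real)) \<Rightarrow> real set" where
  "l2_spectrum \<mu> T =
     {c. \<not> (\<exists>R. l2_bounded_op \<mu> R \<and>
            (\<forall>f\<in>l2_space \<mu>. R (\<lambda>x. T f x - c * f x) = f \<and>
                           (\<lambda>x. T (R f) x - c * R f x) = f))}"

definition normalized_laplacian ::
    "('v \<Rightarrow> 'v \<Rightarrow> real) \<Rightarrow> ('v \<Rightarrow> real) \<Rightarrow> ('v \<Rightarrow> real)" where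
  "normalized_laplacian \<mu> f = (\<lambda>x. f x - 1 / degree \<mu> x * (\<Sum>\<^sub>\<infinity>y. \<mu> x y * f y))"

text \<open>The supremum is taken in the extended reals, where it is meaningful for every set.\<close>

definition top_of_spectrum :: "('v \<Rightarrow> 'v \<Rightarrow> real) \<Rightarrow> ereal" where
  "top_of_spectrum \<mu> = (SUP c\<in>l2_spectrum \<mu> (normalized_laplacian \<mu>). ereal c)"

end

theory Submission
  imports Defs
begin

text \<open>
  Write \<open>\<Delta> = 1 - P\<close>, where \<open>P\<close> is the transition operator of the simple random walk. The spectrum
  of \<open>\<Delta>\<close> has supremum \<open>2\<close> only if that of \<open>P\<close> comes arbitrarily close to \<open>-1\<close>, and returns
  of the walk to its starting point after a fixed odd number of steps prevent this.

  Suppose that the graph is not bipartite. Then every vertex lies on a closed walk of odd length.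
  Closed walks are carried along by automorphisms and can be lengthened by two steps, so finitely
  many orbits leave room for one odd \<open>n\<close> which works for all vertices
  (\<open>common_odd_closed_walk\<close>). Degrees are bounded by some \<open>D\<close>, again because there are
  finitely many orbits, and therefore \<open>p\<^sub>n(x,x) \<ge> \<epsilon>\<close> with \<open>\<epsilon> = D\<^sup>-\<^sup>n\<close> for every \<open>x\<close>
  (\<open>kernel_power_walk\<close>).

  Split \<open>P\<^sup>n = \<epsilon> + Q\<close>. The kernel of \<open>Q\<close> is nonnegative, reversible with respect to the degree, and has
  row sums \<open>1 - \<epsilon>\<close>, so \<open>Q\<close> has norm at most \<open>1 - \<epsilon>\<close> by the Schur test (\<open>kernel_op_l2_bound\<close>). For
  \<open>t \<ge> 0\<close> with \<open>t\<^sup>n > 1 - 2\<epsilon>\<close> the operator \<open>P\<^sup>n + t\<^sup>n = Q + (\<epsilon> + t\<^sup>n)\<close> is then inverted by a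
  Neumann series. As \<open>n\<close> is odd, \<open>P\<^sup>n + t\<^sup>n\<close> is a multiple of \<open>P + t\<close> by an operator commuting with \<open>P\<close>,
  so \<open>P + t = -(\<Delta> - (1 + t))\<close> is invertible as well. By Bernoulli's inequality this covers all
  \<open>t > 1 - \<epsilon>/n\<close>, and no point of the spectrum of \<open>\<Delta>\<close> exceeds \<open>2 - \<epsilon>/n\<close> (\<open>spectrum_gap\<close>).
\<close>

section \<open>Bounds on weighted square sums\<close>

text \<open>
  The statement that the weighted norm of \<open>f\<close> is at most \<open>C\<close>, phrased through finite subsets. In this
  form it includes membership in the Hilbert space, it inherits the triangle inequality from
  \<open>L2_set\<close>, and it survives pointwise limits, which replaces completeness of the space.
\<close>

definition l2_bound :: "('v \<Rightarrow> real) \<Rightarrow> real \<Rightarrow> ('v \<Rightarrow> real) \<Rightarrow> bool" where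
  "l2_bound d C f \<longleftrightarrow> (\<forall>F. finite F \<longrightarrow> L2_set (\<lambda>x. sqrt (d x) * f x) F \<le> C)"

lemma l2_bound_nonneg: "l2_bound d C f \<Longrightarrow> 0 \<le> C"
  unfolding l2_bound_def by (metis L2_set_nonneg finite.emptyI order_trans)

lemma l2_bound_mono: "l2_bound d C f \<Longrightarrow> C \<le> D \<Longrightarrow> l2_bound d D f"
  unfolding l2_bound_def by (meson order_trans)

lemma l2_bound_zero: "l2_bound d 0 (\<lambda>x. 0)"
  by (simp add: l2_bound_def L2_set_def)

lemma l2_bound_add:
  assumes "l2_bound d C f" "l2_bound d D g"
  shows "l2_bound d (C + D) (\<lambda>x. f x + g x)"
  unfolding l2_bound_def
proof (intro allI impI)
  fix F :: "'a set" assume "finite F"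
  have "L2_set (\<lambda>x. sqrt (d x) * (f x + g x)) F
      \<le> L2_set (\<lambda>x. sqrt (d x) * f x) F + L2_set (\<lambda>x. sqrt (d x) * g x) F"
    using L2_set_triangle_ineq[of "\<lambda>x. sqrt (d x) * f x" "\<lambda>x. sqrt (d x) * g x" F]
    by (simp add: distrib_left)
  also have "\<dots> \<le> C + D"
    using assms \<open>finite F\<close> unfolding l2_bound_def by (meson add_mono)
  finally show "L2_set (\<lambda>x. sqrt (d x) * (f x + g x)) F \<le> C + D" .
qed

lemma l2_bound_scale:
  assumes "l2_bound d C f"
  shows "l2_bound d (\<bar>c\<bar> * C) (\<lambda>x. c * f x)"
  unfolding l2_bound_def
proof (intro allI impI)
  fix F :: "'a set" assume "finite F"
  have "L2_set (\<lambda>x. sqrt (d x) * (c * f x)) F = \<bar>c\<bar> * L2_set (\<lambda>x. sqrt (d x) * f x) F"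
    unfolding L2_set_def
    by (simp add: power_mult_distrib mult.left_commute[of _ "c\<^sup>2"] real_sqrt_mult
        flip: sum_distrib_left)
  also have "\<dots> \<le> \<bar>c\<bar> * C"
    using assms \<open>finite F\<close> unfolding l2_bound_def by (simp add: mult_left_mono)
  finally show "L2_set (\<lambda>x. sqrt (d x) * (c * f x)) F \<le> \<bar>c\<bar> * C" .
qed

lemma l2_bound_sum:
  assumes "\<And>i. l2_bound d (C i) (f i)"
  shows "l2_bound d (\<Sum>i<n. C i) (\<lambda>x. \<Sum>i<(n::nat). f i x)"
  by (induction n) (auto intro: l2_bound_zero l2_bound_add assms)

text \<open>
  A form of Fatou's lemma: each finite partial sum is continuous under pointwise convergence.
\<close>

lemma l2_bound_limit:
  fixes f :: "nat \<Rightarrow> 'v \<Rightarrow> real"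
  assumes "\<And>n. l2_bound d C (f n)" and "\<And>x. (\<lambda>n. f n x) \<longlonglongrightarrow> g x"
  shows "l2_bound d C g"
  unfolding l2_bound_def
proof (intro allI impI)
  fix F :: "'v set" assume "finite F"
  have "(\<lambda>n. L2_set (\<lambda>x. sqrt (d x) * f n x) F) \<longlonglongrightarrow> L2_set (\<lambda>x. sqrt (d x) * g x) F"
    unfolding L2_set_def by (intro tendsto_intros assms(2))
  moreover have "L2_set (\<lambda>x. sqrt (d x) * f n x) F \<le> C" for n
    using assms(1) \<open>finite F\<close> unfolding l2_bound_def by blast
  ultimately show "L2_set (\<lambda>x. sqrt (d x) * g x) F \<le> C"
    by (intro LIMSEQ_le_const2) auto
qed

lemma l2_bound_pointwise:
  assumes "l2_bound d C f" "0 < d x"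
  shows "\<bar>f x\<bar> \<le> C / sqrt (d x)"
proof -
  have "L2_set (\<lambda>x. sqrt (d x) * f x) {x} \<le> C"
    using assms(1) unfolding l2_bound_def by blast
  then have "sqrt (d x) * \<bar>f x\<bar> \<le> C"
    using assms(2) by (simp add: L2_set_def abs_mult)
  then show ?thesis
    using assms(2) by (simp add: field_simps)
qed

lemma l2_bound_sq_sum:
  assumes "\<And>x. 0 \<le> d x"
  shows "l2_bound d C f \<longleftrightarrow> 0 \<le> C \<and> (\<forall>F. finite F \<longrightarrow> (\<Sum>x\<in>F. d x * (f x)\<^sup>2) \<le> C\<^sup>2)"
proof -
  have eq: "L2_set (\<lambda>x. sqrt (d x) * f x) F = sqrt (\<Sum>x\<in>F. d x * (f x)\<^sup>2)" for F
    unfolding L2_set_def using assms by (simp add: power_mult_distrib)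
  have "L2_set (\<lambda>x. sqrt (d x) * f x) F \<le> C \<longleftrightarrow> (\<Sum>x\<in>F. d x * (f x)\<^sup>2) \<le> C\<^sup>2" if "0 \<le> C" for F
    using that unfolding eq by (metis abs_of_nonneg real_sqrt_abs real_sqrt_le_iff)
  then show ?thesis
    using l2_bound_nonneg[of d C f] unfolding l2_bound_def by blast
qed

lemma degree_nonneg:
  assumes "weighted_graph \<mu>"
  shows "0 \<le> degree \<mu> x"
  using assms unfolding degree_def weighted_graph_def by (simp add: infsum_nonneg)

text \<open>
  Together with the converse \<open>l2_bound_norm\<close> below, this translates between finite partial sums and
  the infinite sums that define the Hilbert space.
\<close>

lemma l2_norm_le:
  assumes "weighted_graph \<mu>" "l2_bound (degree \<mu>) C f"
  shows "f \<in> l2_space \<mu>" "l2_norm \<mu> f \<le> C"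
proof -
  note d = degree_nonneg[OF assms(1)]
  have C: "0 \<le> C" "\<And>F. finite F \<Longrightarrow> (\<Sum>x\<in>F. degree \<mu> x * (f x)\<^sup>2) \<le> C\<^sup>2"
    using assms(2) unfolding l2_bound_sq_sum[of "degree \<mu>", OF d] by auto
  have s: "(\<lambda>x. degree \<mu> x * (f x)\<^sup>2) summable_on UNIV"
    by (rule nonneg_bounded_partial_sums_imp_summable_on[where C = "C\<^sup>2"])
      (auto simp: d intro!: eventually_finite_subsets_at_top_weakI C(2))
  then show "f \<in> l2_space \<mu>"
    by (simp add: l2_space_def)
  have "l2_inner \<mu> f f \<le> C\<^sup>2"
    using infsum_le_finite_sums[OF s C(2)]
    by (simp add: l2_inner_def power2_eq_square mult.assoc)
  then show "l2_norm \<mu> f \<le> C"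
    unfolding l2_norm_def using C(1) by (metis abs_of_nonneg real_sqrt_abs real_sqrt_le_iff)
qed

lemma l2_bound_norm:
  assumes "weighted_graph \<mu>" "f \<in> l2_space \<mu>"
  shows "l2_bound (degree \<mu>) (l2_norm \<mu> f) f"
proof -
  note d = degree_nonneg[OF assms(1)]
  have s: "(\<lambda>x. degree \<mu> x * (f x)\<^sup>2) summable_on UNIV"
    using assms(2) by (simp add: l2_space_def)
  have e: "l2_inner \<mu> f f = (\<Sum>\<^sub>\<infinity>x. degree \<mu> x * (f x)\<^sup>2)"
    by (simp add: l2_inner_def power2_eq_square mult.assoc)
  have "0 \<le> l2_inner \<mu> f f"
    unfolding e using d by (simp add: infsum_nonneg)
  moreover have "(\<Sum>x\<in>F. degree \<mu> x * (f x)\<^sup>2) \<le> l2_inner \<mu> f f" if "finite F" for F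
    unfolding e using finite_sum_le_infsum[OF s that] d by simp
  ultimately show ?thesis
    unfolding l2_bound_sq_sum[of "degree \<mu>", OF d] l2_norm_def by simp
qed

section \<open>Reversible kernels\<close>

text \<open>
  Summing over the support of a row makes the operator act on arbitrary functions as soon as rows
  are finite, so that identities between operators hold without any summability condition.
\<close>

definition kernel_op :: "('v \<Rightarrow> 'v \<Rightarrow> real) \<Rightarrow> ('v \<Rightarrow> real) \<Rightarrow> 'v \<Rightarrow> real" where
  "kernel_op k f x = (\<Sum>y | k x y \<noteq> 0. k x y * f y)"

definition row_finite :: "('v \<Rightarrow> 'v \<Rightarrow> real) \<Rightarrow> bool" where
  "row_finite k \<longleftrightarrow> (\<forall>x. finite {y. k x y \<noteq> 0})"

text \<open>
  For \<open>r = 1\<close> this is a Markov kernel with reversible measure \<open>d\<close>. General \<open>r\<close> is wanted because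
  removing part of the diagonal lowers all row sums by the same amount.
\<close>

definition reversible_kernel :: "('v \<Rightarrow> real) \<Rightarrow> real \<Rightarrow> ('v \<Rightarrow> 'v \<Rightarrow> real) \<Rightarrow> bool" where
  "reversible_kernel d r k \<longleftrightarrow> row_finite k \<and> (\<forall>x y. 0 \<le> k x y) \<and>
     (\<forall>x y. d x * k x y = d y * k y x) \<and> (\<forall>x. kernel_op k (\<lambda>y. 1) x = r)"

lemma kernel_op_superset:
  assumes "finite S" "{y. k x y \<noteq> 0} \<subseteq> S"
  shows "kernel_op k f x = (\<Sum>y\<in>S. k x y * f y)"
  unfolding kernel_op_def by (rule sum.mono_neutral_left) (use assms in auto)

lemma kernel_op_add: "kernel_op k (\<lambda>x. f x + g x) = (\<lambda>x. kernel_op k f x + kernel_op k g x)"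
  by (simp add: kernel_op_def distrib_left sum.distrib fun_eq_iff)

lemma kernel_op_scale: "kernel_op k (\<lambda>x. c * f x) = (\<lambda>x. c * kernel_op k f x)"
  by (simp add: kernel_op_def sum_distrib_left mult.left_commute fun_eq_iff)

lemma kernel_op_sums:
  assumes "\<And>x. (\<lambda>i. u i x) sums g x"
  shows "(\<lambda>i. kernel_op k (u i) x) sums kernel_op k g x"
  unfolding kernel_op_def by (intro sums_sum sums_mult assms)

lemma reversible_row_sum_nonneg:
  assumes "reversible_kernel d r k"
  shows "0 \<le> r"
proof -
  have "r = kernel_op k (\<lambda>y. 1) undefined" and "\<And>x y. 0 \<le> k x y"
    using assms unfolding reversible_kernel_def by auto
  then show ?thesis by (simp add: kernel_op_def sum_nonneg)
qed

text \<open>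
  The Schur test. By Cauchy-Schwarz along a row, \<open>(K f x)\<^sup>2 \<le> r (\<Sum>y. k x y (f y)\<^sup>2)\<close>; on summing over
  \<open>x\<close> with weight \<open>d x\<close>, reversibility turns the column sums into row sums and yields the second
  factor \<open>r\<close>.
\<close>

lemma kernel_op_l2_bound:
  assumes d: "\<And>x. 0 \<le> d x" and k: "reversible_kernel d r k"
    and f: "l2_bound d C f"
  shows "l2_bound d (r * C) (kernel_op k f)"
  unfolding l2_bound_sq_sum[of d, OF d]
proof (intro conjI allI impI)
  have k0: "0 \<le> k x y" and rev: "d x * k x y = d y * k y x"
    and fin: "finite {y. k x y \<noteq> 0}" and row: "kernel_op k (\<lambda>y. 1) x = r" for x y
    using k unfolding reversible_kernel_def row_finite_def by blast+
  have r: "0 \<le> r" using k by (rule reversible_row_sum_nonneg)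
  have C: "0 \<le> C" "\<And>F. finite F \<Longrightarrow> (\<Sum>x\<in>F. d x * (f x)\<^sup>2) \<le> C\<^sup>2"
    using f unfolding l2_bound_sq_sum[of d, OF d] by auto
  show "0 \<le> r * C" using r C(1) by simp
  fix F :: "'a set" assume F: "finite F"
  \<comment> \<open>The rows indexed by F only see the finite set S, so all sums below are finite.\<close>
  define S where "S = (\<Union>x\<in>F. {y. k x y \<noteq> 0})"
  have S: "finite S" using F fin by (simp add: S_def)
  have opS: "kernel_op k g x = (\<Sum>y\<in>S. k x y * g y)" if "x \<in> F" for g x
    by (rule kernel_op_superset[OF S]) (use that in \<open>auto simp: S_def\<close>)
  have partial_row: "(\<Sum>x\<in>F. k y x) \<le> r" for y
  proof -
    have "(\<Sum>x\<in>F. k y x) \<le> (\<Sum>x\<in>F \<union> {x. k y x \<noteq> 0}. k y x)"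
      using F fin k0 by (intro sum_mono2) auto
    also have "\<dots> = r"
      using kernel_op_superset[of "F \<union> {x. k y x \<noteq> 0}" k y "\<lambda>y. 1"] F fin row by simp
    finally show ?thesis .
  qed
  have cs: "(kernel_op k f x)\<^sup>2 \<le> r * (\<Sum>y\<in>S. k x y * (f y)\<^sup>2)" if x: "x \<in> F" for x
  proof -
    have "(kernel_op k f x)\<^sup>2 = (\<Sum>y\<in>S. sqrt (k x y) * (sqrt (k x y) * f y))\<^sup>2"
      unfolding opS[OF x] using k0 by (simp flip: mult.assoc)
    also have "\<dots> \<le> (\<Sum>y\<in>S. (sqrt (k x y))\<^sup>2) * (\<Sum>y\<in>S. (sqrt (k x y) * f y)\<^sup>2)"
      by (rule Cauchy_Schwarz_ineq_sum)
    also have "\<dots> = r * (\<Sum>y\<in>S. k x y * (f y)\<^sup>2)"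
      using opS[OF x, of "\<lambda>y. 1"] row[of x] k0 by (simp add: power_mult_distrib)
    finally show ?thesis .
  qed
  have "(\<Sum>x\<in>F. d x * (kernel_op k f x)\<^sup>2) \<le> (\<Sum>x\<in>F. d x * (r * (\<Sum>y\<in>S. k x y * (f y)\<^sup>2)))"
    using d cs by (intro sum_mono mult_left_mono) auto
  also have "\<dots> = (\<Sum>x\<in>F. \<Sum>y\<in>S. r * ((d x * k x y) * (f y)\<^sup>2))"
    by (simp add: sum_distrib_left mult_ac)
  also have "\<dots> = (\<Sum>y\<in>S. \<Sum>x\<in>F. r * ((d y * k y x) * (f y)\<^sup>2))"
    by (subst sum.swap) (simp only: rev)
  also have "\<dots> = (\<Sum>y\<in>S. r * (d y * (f y)\<^sup>2) * (\<Sum>x\<in>F. k y x))"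
    by (intro sum.cong refl, subst sum_distrib_left, intro sum.cong refl) (simp add: mult_ac)
  also have "\<dots> \<le> (\<Sum>y\<in>S. r * (d y * (f y)\<^sup>2) * r)"
    using r d partial_row by (intro sum_mono mult_left_mono) auto
  also have "\<dots> = r\<^sup>2 * (\<Sum>y\<in>S. d y * (f y)\<^sup>2)"
    by (simp add: sum_distrib_left power2_eq_square mult_ac)
  also have "\<dots> \<le> (r * C)\<^sup>2"
    using C(2)[OF S] by (simp add: power_mult_distrib mult_left_mono)
  finally show "(\<Sum>x\<in>F. d x * (kernel_op k f x)\<^sup>2) \<le> (r * C)\<^sup>2" .
qed

definition kernel_comp :: "('v \<Rightarrow> 'v \<Rightarrow> real) \<Rightarrow> ('v \<Rightarrow> 'v \<Rightarrow> real) \<Rightarrow> 'v \<Rightarrow> 'v \<Rightarrow> real" where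
  "kernel_comp k l x y = kernel_op k (\<lambda>z. l z y) x"

primrec kernel_power :: "('v \<Rightarrow> 'v \<Rightarrow> real) \<Rightarrow> nat \<Rightarrow> 'v \<Rightarrow> 'v \<Rightarrow> real" where
  "kernel_power k 0 = (\<lambda>x y. if x = y then 1 else 0)"
| "kernel_power k (Suc n) = kernel_comp k (kernel_power k n)"

lemma kernel_comp_support:
  "{y. kernel_comp k l x y \<noteq> 0} \<subseteq> (\<Union>z\<in>{z. k x z \<noteq> 0}. {y. l z y \<noteq> 0})"
proof
  fix y assume "y \<in> {y. kernel_comp k l x y \<noteq> 0}"
  then have "(\<Sum>z | k x z \<noteq> 0. k x z * l z y) \<noteq> 0"
    by (simp add: kernel_comp_def kernel_op_def)
  then obtain z where "k x z \<noteq> 0" "k x z * l z y \<noteq> 0"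
    by (metis (mono_tags, lifting) mem_Collect_eq sum.neutral)
  then show "y \<in> (\<Union>z\<in>{z. k x z \<noteq> 0}. {y. l z y \<noteq> 0})" by auto
qed

lemma row_finite_comp:
  assumes "row_finite k" "row_finite l"
  shows "row_finite (kernel_comp k l)"
  unfolding row_finite_def
proof
  fix x
  show "finite {y. kernel_comp k l x y \<noteq> 0}"
    by (rule finite_subset[OF kernel_comp_support]) (use assms in \<open>auto simp: row_finite_def\<close>)
qed

lemma kernel_op_comp:
  assumes "row_finite k" "row_finite l"
  shows "kernel_op (kernel_comp k l) f = kernel_op k (kernel_op l f)"
proof
  fix x
  define S where "S = (\<Union>z\<in>{z. k x z \<noteq> 0}. {y. l z y \<noteq> 0})"
  have S: "finite S" using assms by (auto simp: S_def row_finite_def)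
  have "kernel_op (kernel_comp k l) f x = (\<Sum>y\<in>S. kernel_comp k l x y * f y)"
    using kernel_comp_support[of k l x] by (intro kernel_op_superset[OF S]) (simp add: S_def)
  also have "\<dots> = (\<Sum>y\<in>S. \<Sum>z | k x z \<noteq> 0. k x z * (l z y * f y))"
    by (simp add: kernel_comp_def kernel_op_def sum_distrib_right mult.assoc)
  also have "\<dots> = (\<Sum>z | k x z \<noteq> 0. k x z * (\<Sum>y\<in>S. l z y * f y))"
    by (subst sum.swap) (simp add: sum_distrib_left)
  also have "\<dots> = (\<Sum>z | k x z \<noteq> 0. k x z * kernel_op l f z)"
    by (intro sum.cong refl arg_cong2[where f = "(*)"] kernel_op_superset[symmetric] S)
      (auto simp: S_def)
  finally show "kernel_op (kernel_comp k l) f x = kernel_op k (kernel_op l f) x"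
    by (simp add: kernel_op_def)
qed

text \<open>
  A column of a composite kernel is the first operator applied to a column of the second kernel, so
  associativity is the composition rule for operators applied to columns.
\<close>

lemma kernel_comp_assoc:
  assumes "row_finite k" "row_finite l"
  shows "kernel_comp (kernel_comp k l) m = kernel_comp k (kernel_comp l m)"
  using kernel_op_comp[OF assms] by (simp add: kernel_comp_def[abs_def] fun_eq_iff)

lemma row_finite_power: "row_finite k \<Longrightarrow> row_finite (kernel_power k n)"
proof (induction n)
  case 0
  then show ?case by (simp add: row_finite_def)
qed (simp add: row_finite_comp)

lemma kernel_op_power_0 [simp]: "kernel_op (kernel_power k 0) f = f"
proof
  show "kernel_op (kernel_power k 0) f x = f x" for x
    using kernel_op_superset[of "{x}" "kernel_power k 0" x f] by auto
qed

lemma kernel_comp_power_0: "row_finite k \<Longrightarrow> kernel_comp k (kernel_power k 0) = k"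
proof (intro ext)
  fix x y assume k: "row_finite k"
  have "kernel_comp k (kernel_power k 0) x y
      = (\<Sum>z\<in>insert y {z. k x z \<noteq> 0}. k x z * (if z = y then 1 else 0))"
    unfolding kernel_comp_def using k
    by (subst kernel_op_superset[of "insert y {z. k x z \<noteq> 0}"]) (auto simp: row_finite_def)
  also have "\<dots> = k x y"
    using k by (simp add: row_finite_def if_distrib cong: if_cong)
  finally show "kernel_comp k (kernel_power k 0) x y = k x y" .
qed

text \<open>
  Needed for reversibility of the powers, since transposition reverses the order of a composition.
\<close>

lemma kernel_power_commute:
  assumes "row_finite k"
  shows "kernel_comp (kernel_power k n) k = kernel_comp k (kernel_power k n)"
proof (induction n)
  case 0
  have "kernel_comp (kernel_power k 0) k = k"
    by (simp add: kernel_comp_def[abs_def] del: kernel_power.simps)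
  with kernel_comp_power_0[OF assms] show ?case by simp
next
  case (Suc n)
  then show ?case
    using assms by (simp add: kernel_comp_assoc row_finite_power)
qed

lemma reversible_comp:
  assumes "reversible_kernel d r k" "reversible_kernel d s l"
  shows "d x * kernel_comp k l x y = d y * kernel_comp l k y x"
proof -
  have k: "d x * k x y = d y * k y x" "row_finite k"
    and l: "d x * l x y = d y * l y x" "row_finite l" for x y
    using assms unfolding reversible_kernel_def by blast+
  define S where "S = {z. k x z \<noteq> 0} \<union> {z. l y z \<noteq> 0}"
  have S: "finite S" using k(2) l(2) by (simp add: S_def row_finite_def)
  have "d x * kernel_comp k l x y = (\<Sum>z\<in>S. (d x * k x z) * l z y)"
    unfolding kernel_comp_def
    by (subst kernel_op_superset[OF S]) (auto simp: S_def sum_distrib_left mult_ac)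
  also have "\<dots> = (\<Sum>z\<in>S. (d z * l z y) * k z x)"
    by (simp add: k(1)[of x] mult_ac)
  also have "\<dots> = (\<Sum>z\<in>S. (d y * l y z) * k z x)"
    by (simp only: l(1)[of _ y])
  also have "\<dots> = d y * kernel_comp l k y x"
    unfolding kernel_comp_def
    by (subst kernel_op_superset[OF S]) (auto simp: S_def sum_distrib_left mult_ac)
  finally show ?thesis .
qed

lemma reversible_power:
  assumes "reversible_kernel d 1 k"
  shows "reversible_kernel d 1 (kernel_power k n)"
proof (induction n)
  case 0
  show ?case
    unfolding reversible_kernel_def kernel_op_power_0 by (auto simp: row_finite_def)
next
  case (Suc n)
  have k: "row_finite k" "\<And>x y. 0 \<le> k x y" "kernel_op k (\<lambda>y. 1) = (\<lambda>x. 1)"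
    using assms unfolding reversible_kernel_def by auto
  have p: "\<And>x y. 0 \<le> kernel_power k n x y" "kernel_op (kernel_power k n) (\<lambda>y. 1) = (\<lambda>x. 1)"
    using Suc unfolding reversible_kernel_def by auto
  show ?case
    unfolding reversible_kernel_def
  proof (intro conjI allI)
    show "row_finite (kernel_power k (Suc n))" using k(1) by (rule row_finite_power)
    show "0 \<le> kernel_power k (Suc n) x y" for x y
      using k p by (simp add: kernel_comp_def kernel_op_def sum_nonneg)
    show "d x * kernel_power k (Suc n) x y = d y * kernel_power k (Suc n) y x" for x y
      using reversible_comp[OF assms Suc, of x y] kernel_power_commute[OF k(1), of n] by simp
    show "kernel_op (kernel_power k (Suc n)) (\<lambda>y. 1) x = 1" for x
      using k p by (simp add: kernel_op_comp row_finite_power)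
  qed
qed

lemma reversible_remove_diagonal:
  assumes "reversible_kernel d r k" and "\<And>x. \<epsilon> \<le> k x x"
  defines "q \<equiv> (\<lambda>x y. k x y - (if x = y then \<epsilon> else 0))"
  shows "kernel_op q f x = kernel_op k f x - \<epsilon> * f x"
    and "reversible_kernel d (r - \<epsilon>) q"
proof -
  have k: "finite {y. k x y \<noteq> 0}" "0 \<le> k x y" "d x * k x y = d y * k y x"
     "kernel_op k (\<lambda>y. 1) x = r" for x y
    using assms(1) unfolding reversible_kernel_def row_finite_def by blast+
  have sub: "{y. q x y \<noteq> 0} \<subseteq> insert x {y. k x y \<noteq> 0}" for x
    by (auto simp: q_def split: if_splits)
  have op: "kernel_op q f x = kernel_op k f x - \<epsilon> * f x" for f x
  proof -
    have "kernel_op q f x = (\<Sum>y\<in>insert x {y. k x y \<noteq> 0}. q x y * f y)"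
      using k sub by (intro kernel_op_superset) auto
    also have "\<dots> = (\<Sum>y\<in>insert x {y. k x y \<noteq> 0}. k x y * f y)
        - (\<Sum>y\<in>insert x {y. k x y \<noteq> 0}. if x = y then \<epsilon> * f y else 0)"
      unfolding q_def left_diff_distrib sum_subtractf
      by (intro arg_cong2[where f = "(-)"] sum.cong) auto
    also have "\<dots> = kernel_op k f x - \<epsilon> * f x"
      using k kernel_op_superset[of "insert x {y. k x y \<noteq> 0}" k x f] by (simp add: subset_insertI)
    finally show ?thesis .
  qed
  show "kernel_op q f x = kernel_op k f x - \<epsilon> * f x" by (rule op)
  have "finite {y. q x y \<noteq> 0}" for x
    using finite_subset[OF sub] k(1) by simp
  moreover have "0 \<le> q x y" "d x * q x y = d y * q y x" for x y
    using k assms(2) by (auto simp: q_def)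
  ultimately show "reversible_kernel d (r - \<epsilon>) q"
    using k(4) unfolding reversible_kernel_def row_finite_def op by simp
qed

section \<open>Inverting operators on the weighted square-summable functions\<close>

text \<open>
  The Neumann series \<open>g = (\<Sum>i. (-Q/a)^i (f/a))\<close>, for an operator \<open>Q\<close> of norm at most \<open>r < a\<close>. It
  converges at every vertex because single values are controlled by the norm. As the rows of \<open>q\<close> are
  finite, \<open>Q\<close> may be applied term by term.
\<close>

lemma shifted_contraction_solve:
  assumes d: "\<And>x. 0 < d x" and q: "reversible_kernel d r q" and ra: "r < a"
    and f: "l2_bound d C f"
  shows "\<exists>g. l2_bound d (C / (a - r)) g \<and> (\<forall>x. kernel_op q g x + a * g x = f x)"
proof -
  have r: "0 \<le> r" using q by (rule reversible_row_sum_nonneg)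
  then have a: "0 < a" using ra by simp
  define \<rho> where "\<rho> = r / a"
  have \<rho>: "0 \<le> \<rho>" "\<rho> < 1" using r ra by (auto simp: \<rho>_def)
  have C: "0 \<le> C" using f by (rule l2_bound_nonneg)
  \<comment> \<open>The i-th term of the series; its norm is at most (C / a) (r / a)^i.\<close>
  define u where "u i = ((\<lambda>h x. (- 1 / a) * kernel_op q h x) ^^ i) (\<lambda>x. 1 / a * f x)" for i
  have u_Suc: "u (Suc i) x = (- 1 / a) * kernel_op q (u i) x" for i x
    by (simp add: u_def)
  have bnd: "l2_bound d (C / a * \<rho> ^ i) (u i)" for i
  proof (induction i)
    case 0
    show ?case
      using l2_bound_scale[OF f, of "1 / a"] a by (simp add: u_def)
  next
    case (Suc i)
    have "l2_bound d (\<bar>- 1 / a\<bar> * (r * (C / a * \<rho> ^ i))) (\<lambda>x. (- 1 / a) * kernel_op q (u i) x)"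
      by (intro l2_bound_scale kernel_op_l2_bound q Suc less_imp_le[OF d])
    then show ?case
      using a by (simp add: u_Suc[abs_def] \<rho>_def mult_ac)
  qed
  have summable_u: "summable (\<lambda>i. u i x)" for x
  proof (rule summable_comparison_test)
    show "\<exists>N. \<forall>n\<ge>N. norm (u n x) \<le> C / a / sqrt (d x) * \<rho> ^ n"
      using l2_bound_pointwise[OF bnd d] by (auto simp: mult_ac)
    show "summable (\<lambda>n. C / a / sqrt (d x) * \<rho> ^ n)"
      using \<rho> by (intro summable_mult summable_geometric) simp
  qed
  define g where "g x = (\<Sum>i. u i x)" for x
  have g: "(\<lambda>i. u i x) sums g x" for x
    using summable_u unfolding g_def by (rule summable_sums)
  have partial: "l2_bound d (C / (a - r)) (\<lambda>x. \<Sum>i<n. u i x)" for n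
  proof (rule l2_bound_mono[OF l2_bound_sum[OF bnd]])
    have "(\<Sum>i<n. \<rho> ^ i) \<le> 1 / (1 - \<rho>)"
      using \<rho> sum_le_suminf[of "\<lambda>i. \<rho> ^ i" "{..<n}"] suminf_geometric[of \<rho>]
      by (simp add: summable_geometric)
    then have "C / a * (\<Sum>i<n. \<rho> ^ i) \<le> C / a * (1 / (1 - \<rho>))"
      using C a by (intro mult_left_mono) auto
    also have "\<dots> = C / (a - r)"
      using a ra by (simp add: \<rho>_def field_simps)
    finally show "(\<Sum>i<n. C / a * \<rho> ^ i) \<le> C / (a - r)"
      by (simp add: sum_distrib_left)
  qed
  have "l2_bound d (C / (a - r)) g"
    using partial g unfolding sums_def by (rule l2_bound_limit)
  moreover have "kernel_op q g x + a * g x = f x" for x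
  proof -
    have "(\<lambda>i. u (Suc i) x) sums ((- 1 / a) * kernel_op q g x)"
      unfolding u_Suc by (intro sums_mult kernel_op_sums g)
    moreover have "(\<lambda>i. u (Suc i) x) sums (g x - u 0 x)"
      using g[of x] sums_Suc_iff[of "\<lambda>i. u i x"] by simp
    ultimately have "(- 1 / a) * kernel_op q g x = g x - f x / a"
      using sums_unique2 by (fastforce simp: u_def)
    then show ?thesis using a by (simp add: field_simps)
  qed
  ultimately show ?thesis by blast
qed

text \<open>
  A solution of \<open>Q f = -a f\<close> can have its norm bound improved by the factor \<open>r / a < 1\<close> again and again.
\<close>

lemma shifted_contraction_inj:
  assumes d: "\<And>x. 0 < d x" and q: "reversible_kernel d r q" and ra: "r < a"
    and f: "l2_bound d C f" and eq: "\<And>x. kernel_op q f x + a * f x = 0"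
  shows "f x = 0"
proof -
  have r: "0 \<le> r" using q by (rule reversible_row_sum_nonneg)
  then have a: "0 < a" using ra by simp
  have fx: "f = (\<lambda>x. (- 1 / a) * kernel_op q f x)"
  proof
    show "f x = (- 1 / a) * kernel_op q f x" for x using eq[of x] a by (simp add: field_simps)
  qed
  have bnd: "l2_bound d (C * (r / a) ^ n) f" for n
  proof (induction n)
    case 0
    then show ?case using f by simp
  next
    case (Suc n)
    have "l2_bound d (\<bar>- 1 / a\<bar> * (r * (C * (r / a) ^ n))) (\<lambda>x. (- 1 / a) * kernel_op q f x)"
      by (intro l2_bound_scale kernel_op_l2_bound q Suc less_imp_le[OF d])
    then show ?case
      using a fx by (simp add: mult_ac)
  qed
  have "(\<lambda>n. C * (r / a) ^ n / sqrt (d x)) \<longlonglongrightarrow> C * 0 / sqrt (d x)"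
    using r ra d[of x] by (intro tendsto_intros LIMSEQ_power_zero) auto
  moreover have "\<bar>f x\<bar> \<le> C * (r / a) ^ n / sqrt (d x)" for n
    using l2_bound_pointwise[of d, OF bnd d] .
  ultimately have "\<bar>f x\<bar> \<le> 0"
    by (metis (no_types, lifting) LIMSEQ_le_const mult_zero_right div_0)
  then show ?thesis by simp
qed

text \<open>
  The operator \<open>\<Sum>j<n. (-t)^(n-1-j) K^j\<close>, the quotient of \<open>K^n - (-t)^n\<close> by \<open>K + t\<close>, evaluated by
  Horner's scheme.
\<close>

primrec power_cofactor ::
    "('v \<Rightarrow> 'v \<Rightarrow> real) \<Rightarrow> real \<Rightarrow> nat \<Rightarrow> ('v \<Rightarrow> real) \<Rightarrow> 'v \<Rightarrow> real" where
  "power_cofactor k t 0 f = (\<lambda>x. 0)"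
| "power_cofactor k t (Suc n) f =
     (\<lambda>x. kernel_op (kernel_power k n) f x + (- t) * power_cofactor k t n f x)"

lemma power_cofactor_left:
  assumes "row_finite k"
  shows "kernel_op k (power_cofactor k t n f) x + t * power_cofactor k t n f x
      = kernel_op (kernel_power k n) f x - (- t) ^ n * f x"
proof (induction n)
  case 0
  show ?case by (simp add: kernel_op_def[of k] del: kernel_power.simps)
next
  case (Suc n)
  have "kernel_op k (power_cofactor k t (Suc n) f) x + t * power_cofactor k t (Suc n) f x
      = kernel_op (kernel_power k (Suc n)) f x + t * kernel_op (kernel_power k n) f x
        - t * (kernel_op k (power_cofactor k t n f) x + t * power_cofactor k t n f x)"
    using assms
    by (simp only: power_cofactor.simps kernel_op_add kernel_op_scale kernel_power.simps
        kernel_op_comp row_finite_power) (simp add: algebra_simps)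
  also have "\<dots> = kernel_op (kernel_power k (Suc n)) f x - (- t) ^ Suc n * f x"
    unfolding Suc by (simp add: algebra_simps)
  finally show ?case .
qed

lemma power_cofactor_right:
  assumes "row_finite k"
  shows "power_cofactor k t n (\<lambda>x. kernel_op k f x + t * f x) x
      = kernel_op (kernel_power k n) f x - (- t) ^ n * f x"
proof (induction n)
  case 0
  show ?case by (simp del: kernel_power.simps)
next
  case (Suc n)
  have "kernel_op (kernel_power k n) (kernel_op k f) = kernel_op (kernel_power k (Suc n)) f"
    using assms by (simp add: row_finite_power kernel_power_commute flip: kernel_op_comp)
  then show ?case
    unfolding power_cofactor.simps Suc kernel_op_add kernel_op_scale
    by (simp add: algebra_simps)
qed

lemma power_cofactor_bound:
  assumes d: "\<And>x. 0 \<le> d x" and k: "reversible_kernel d 1 k" and f: "l2_bound d C f"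
  shows "l2_bound d ((\<Sum>i<n. \<bar>t\<bar> ^ i) * C) (power_cofactor k t n f)"
proof (induction n)
  case 0
  show ?case by (simp add: l2_bound_zero)
next
  case (Suc n)
  have "l2_bound d (1 * C + \<bar>- t\<bar> * ((\<Sum>i<n. \<bar>t\<bar> ^ i) * C)) (power_cofactor k t (Suc n) f)"
    unfolding power_cofactor.simps
    by (intro l2_bound_add l2_bound_scale Suc kernel_op_l2_bound d reversible_power k f)
  then show ?case
    by (simp add: sum.lessThan_Suc_shift sum_distrib_left sum_distrib_right algebra_simps
        del: sum.lessThan_Suc)
qed

text \<open>
  Linearity of the inverse and the identity \<open>R (T f) = f\<close> both follow from injectivity of \<open>T\<close>, so it
  suffices to solve \<open>T g = f\<close> with a norm bound, for each \<open>f\<close> separately.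
\<close>

lemma l2_bounded_inverse:
  assumes \<mu>: "weighted_graph \<mu>"
    and T_add: "\<And>f g x. T (\<lambda>x. f x + g x) x = T f x + T g x"
    and T_scale: "\<And>c f x. T (\<lambda>x. c * f x) x = c * T f x"
    and T_l2: "\<And>f. f \<in> l2_space \<mu> \<Longrightarrow> T f \<in> l2_space \<mu>"
    and T_inj: "\<And>f. f \<in> l2_space \<mu> \<Longrightarrow> (\<And>x. T f x = 0) \<Longrightarrow> f = (\<lambda>x. 0)"
    and T_solve: "\<And>f. f \<in> l2_space \<mu> \<Longrightarrow>
      \<exists>g. l2_bound (degree \<mu>) (K * l2_norm \<mu> f) g \<and> T g = f"
  shows "\<exists>R. l2_bounded_op \<mu> R \<and> (\<forall>f\<in>l2_space \<mu>. R (T f) = f \<and> T (R f) = f)"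
proof -
  note in_l2 = l2_norm_le(1)[OF \<mu>] and norm = l2_bound_norm[OF \<mu>]
  have add_l2: "(\<lambda>x. f x + g x) \<in> l2_space \<mu>" if "f \<in> l2_space \<mu>" "g \<in> l2_space \<mu>" for f g
    using l2_bound_add[OF norm[OF that(1)] norm[OF that(2)]] by (rule in_l2)
  have scale_l2: "(\<lambda>x. c * f x) \<in> l2_space \<mu>" if "f \<in> l2_space \<mu>" for c f
    using l2_bound_scale[OF norm[OF that]] by (rule in_l2)
  have uniq: "f = g" if "f \<in> l2_space \<mu>" "g \<in> l2_space \<mu>" "T f = T g" for f g
  proof -
    have "T (\<lambda>x. f x + (- 1) * g x) x = 0" for x
      unfolding T_add T_scale using that(3) by simp
    then have "(\<lambda>x. f x + (- 1) * g x) = (\<lambda>x. 0)"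
      by (intro T_inj add_l2 scale_l2 that)
    then show ?thesis by (simp add: fun_eq_iff)
  qed
  obtain R where R: "\<And>f. f \<in> l2_space \<mu> \<Longrightarrow>
      l2_bound (degree \<mu>) (K * l2_norm \<mu> f) (R f) \<and> T (R f) = f"
    using T_solve by metis
  then have R_l2: "R f \<in> l2_space \<mu>" and TR: "T (R f) = f" if "f \<in> l2_space \<mu>" for f
    using that in_l2 by blast+
  have "l2_bounded_op \<mu> R"
    unfolding l2_bounded_op_def
  proof (intro conjI ballI allI exI)
    show "R f \<in> l2_space \<mu>" if "f \<in> l2_space \<mu>" for f by (rule R_l2[OF that])
    show "R (\<lambda>x. f x + g x) = (\<lambda>x. R f x + R g x)" if "f \<in> l2_space \<mu>" "g \<in> l2_space \<mu>" for f g
      by (rule uniq) (simp_all add: that R_l2 add_l2 TR T_add fun_eq_iff)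
    show "R (\<lambda>x. c * f x) = (\<lambda>x. c * R f x)" if "f \<in> l2_space \<mu>" for c f
      by (rule uniq) (simp_all add: that R_l2 scale_l2 TR T_scale fun_eq_iff)
    show "l2_norm \<mu> (R f) \<le> K * l2_norm \<mu> f" if "f \<in> l2_space \<mu>" for f
      using R[OF that] l2_norm_le(2)[OF \<mu>] by blast
  qed
  moreover have "R (T f) = f" if "f \<in> l2_space \<mu>" for f
    by (rule uniq) (simp_all add: that R_l2 T_l2 TR)
  ultimately show ?thesis using TR by blast
qed

lemma power_cofactor_zero: "power_cofactor k t n (\<lambda>x. 0) = (\<lambda>x. 0)"
  by (induction n) (simp_all add: kernel_op_def)

text \<open>
  The factorisation \<open>P\<^sup>n + t\<^sup>n = (P + t) B = B (P + t)\<close> with \<open>t = c - 1\<close> transfers invertibility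
  from \<open>P\<^sup>n + t\<^sup>n\<close> to \<open>P + t\<close>: the right factorisation \<open>B (P + t)\<close> gives injectivity, and \<open>(P + t) B\<close>
  shows that \<open>B\<close> maps solutions for the former to solutions for the latter.
\<close>

lemma spectrum_gap:
  assumes \<mu>: "weighted_graph \<mu>" and d: "\<And>x. 0 < degree \<mu> x"
    and p: "reversible_kernel (degree \<mu>) 1 p"
    and laplacian: "\<And>f x. normalized_laplacian \<mu> f x = f x - kernel_op p f x"
    and n: "odd n" and \<epsilon>: "0 < \<epsilon>" "\<And>x. \<epsilon> \<le> kernel_power p n x x"
    and c: "c \<in> l2_spectrum \<mu> (normalized_laplacian \<mu>)"
  shows "c \<le> 2 - \<epsilon> / n"
proof (rule ccontr)
  assume "\<not> c \<le> 2 - \<epsilon> / n"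
  define t where "t = c - 1"
  define q where "q = (\<lambda>x y. kernel_power p n x y - (if x = y then \<epsilon> else 0))"
  define a where "a = \<epsilon> + t ^ n"
  define T where "T = (\<lambda>f x. normalized_laplacian \<mu> f x - c * f x)"
  note in_l2 = l2_norm_le(1)[OF \<mu>] and norm = l2_bound_norm[OF \<mu>]
  have n0: "0 < n" using n by (simp add: odd_pos)
  have fin: "row_finite p" using p by (simp add: reversible_kernel_def)
  have q: "reversible_kernel (degree \<mu>) (1 - \<epsilon>) q"
    and q_op: "kernel_op q f x = kernel_op (kernel_power p n) f x - \<epsilon> * f x" for f x
    using reversible_remove_diagonal[OF reversible_power[OF p] \<epsilon>(2)] unfolding q_def by auto
  have "\<epsilon> \<le> 1" using reversible_row_sum_nonneg[OF q] by simp
  then have small: "\<epsilon> / n \<le> 1"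
    using n0 by (simp add: divide_le_eq)
  \<comment> \<open>Bernoulli's inequality yields t^n >= 1 - \<open>\<epsilon>\<close>, hence a > 1 - \<open>\<epsilon>\<close>, the row sum of q.\<close>
  have "1 - \<epsilon> = 1 + n * (- (\<epsilon> / n))" using n0 by simp
  also have "\<dots> \<le> (1 + - (\<epsilon> / n)) ^ n"
    using small by (intro Bernoulli_inequality) simp
  also have "\<dots> \<le> t ^ n"
    using \<open>\<not> c \<le> 2 - \<epsilon> / n\<close> small by (intro power_mono) (auto simp: t_def)
  finally have a: "1 - \<epsilon> < a" using \<epsilon>(1) by (simp add: a_def)
  \<comment> \<open>Here n has to be odd: it makes t^n equal to - (- t)^n.\<close>
  have shifted: "kernel_op q f x + a * f x
      = kernel_op (kernel_power p n) f x - (- t) ^ n * f x" for f x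
    using n by (simp add: q_op a_def algebra_simps)
  have T: "T f x = - (kernel_op p f x + t * f x)" for f x
    by (simp add: T_def laplacian t_def algebra_simps)
  define K where "K = (\<Sum>i<n. \<bar>t\<bar> ^ i) / (a - (1 - \<epsilon>))"
  have "\<exists>R. l2_bounded_op \<mu> R \<and> (\<forall>f\<in>l2_space \<mu>. R (T f) = f \<and> T (R f) = f)"
  proof (rule l2_bounded_inverse[OF \<mu>])
    show "T (\<lambda>x. f x + g x) x = T f x + T g x" for f g x
      by (simp add: T kernel_op_add algebra_simps)
    show "T (\<lambda>x. b * f x) x = b * T f x" for b f x
      by (simp add: T kernel_op_scale algebra_simps)
    show "T f \<in> l2_space \<mu>" if f: "f \<in> l2_space \<mu>" for f
    proof (rule in_l2)
      show "l2_bound (degree \<mu>) (\<bar>- 1\<bar> * (1 * l2_norm \<mu> f + \<bar>t\<bar> * l2_norm \<mu> f)) (T f)"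
        using l2_bound_scale[of _ _ _ "- 1", OF l2_bound_add[OF
            kernel_op_l2_bound[OF less_imp_le[OF d] p norm[OF f]] l2_bound_scale[OF norm[OF f], of t]]]
        by (simp add: T[abs_def])
    qed
    show "f = (\<lambda>x. 0)" if f: "f \<in> l2_space \<mu>" and Tf: "\<And>x. T f x = 0" for f
    proof
      have "(\<lambda>x. kernel_op p f x + t * f x) = (\<lambda>x. 0)"
        using Tf unfolding T neg_equal_0_iff_equal by blast
      then have "kernel_op q f x + a * f x = 0" for x
        using power_cofactor_right[OF fin, of t n f x] by (simp add: shifted power_cofactor_zero)
      then show "f x = 0" for x
        using shifted_contraction_inj[OF d q a norm[OF f]] by blast
    qed
    show "\<exists>g. l2_bound (degree \<mu>) (K * l2_norm \<mu> f) g \<and> T g = f" if f: "f \<in> l2_space \<mu>" for f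
    proof -
      have "l2_bound (degree \<mu>) (l2_norm \<mu> f) (\<lambda>x. - f x)"
        using l2_bound_scale[OF norm[OF f], of "- 1"] by simp
      then obtain g where g: "l2_bound (degree \<mu>) (l2_norm \<mu> f / (a - (1 - \<epsilon>))) g"
          "\<And>x. kernel_op q g x + a * g x = - f x"
        using shifted_contraction_solve[OF d q a] by blast
      have "l2_bound (degree \<mu>) (K * l2_norm \<mu> f) (power_cofactor p t n g)"
        using power_cofactor_bound[OF less_imp_le[OF d] p g(1)] by (simp add: K_def)
      moreover have "T (power_cofactor p t n g) = f"
        using g(2)
        by (simp add: fun_eq_iff T power_cofactor_left[OF fin] shifted[symmetric])
      ultimately show ?thesis by blast
    qed
  qed
  then have "c \<notin> l2_spectrum \<mu> (normalized_laplacian \<mu>)"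
    unfolding l2_spectrum_def T_def by auto
  with c show False by contradiction
qed

section \<open>Walks in graphs\<close>

lemma adj_commute: "weighted_graph \<mu> \<Longrightarrow> adj \<mu> x y \<longleftrightarrow> adj \<mu> y x"
  by (simp add: adj_def weighted_graph_def)

lemma walk_reverse:
  assumes "weighted_graph \<mu>"
  shows "(adj \<mu> ^^ n) x y \<Longrightarrow> (adj \<mu> ^^ n) y x"
proof (induction n arbitrary: y)
  case (Suc n)
  then obtain z where "(adj \<mu> ^^ n) x z" "adj \<mu> z y" by auto
  then show ?case
    using Suc.IH adj_commute[OF assms] by (meson relpowp_Suc_I2)
qed simp

lemma walk_append: "(R ^^ m) x y \<Longrightarrow> (R ^^ n) y z \<Longrightarrow> (R ^^ (m + n)) x z"
  by (auto simp: relpowp_add)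

lemma even_closed_walk:
  assumes "weighted_graph \<mu>" "adj \<mu> x y"
  shows "(adj \<mu> ^^ (2 * k)) x x"
proof (induction k)
  case (Suc k)
  then have "(adj \<mu> ^^ Suc (Suc (2 * k))) x x"
    using assms adj_commute by (metis relpowp_Suc_I)
  then show ?case by simp
qed simp

text \<open>
  Otherwise the parity of walks from \<open>x\<close> is determined by their end points and defines a bipartition.
\<close>

lemma odd_closed_walk:
  assumes \<mu>: "weighted_graph \<mu>" and con: "connected_graph \<mu>" and nb: "\<not> bipartite_graph \<mu>"
  shows "\<exists>n. odd n \<and> (adj \<mu> ^^ n) x x"
proof (rule ccontr)
  assume none: "\<not> ?thesis"
  define V1 where "V1 = {y. \<exists>n. even n \<and> (adj \<mu> ^^ n) x y}"
  define V2 where "V2 = {y. \<exists>n. odd n \<and> (adj \<mu> ^^ n) x y}"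
  have un: "V1 \<union> V2 = UNIV"
    using con unfolding connected_graph_def V1_def V2_def rtranclp_power by blast
  have disj: "V1 \<inter> V2 = {}"
  proof (rule ccontr)
    assume "V1 \<inter> V2 \<noteq> {}"
    then obtain y m n where y: "even m" "(adj \<mu> ^^ m) x y" "odd n" "(adj \<mu> ^^ n) x y"
      unfolding V1_def V2_def by blast
    then have "odd (m + n)" by simp
    moreover have "(adj \<mu> ^^ (m + n)) x x"
      by (rule walk_append[OF y(2) walk_reverse[OF \<mu> y(4)]])
    ultimately show False using none by blast
  qed
  have step: "y \<in> V1 \<Longrightarrow> z \<in> V2" "y \<in> V2 \<Longrightarrow> z \<in> V1" if "adj \<mu> y z" for y z
  proof -
    have ext: "(adj \<mu> ^^ Suc n) x z" if "(adj \<mu> ^^ n) x y" for n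
      using that \<open>adj \<mu> y z\<close> by (rule relpowp_Suc_I)
    show "y \<in> V1 \<Longrightarrow> z \<in> V2" unfolding V1_def V2_def using ext even_Suc by blast
    show "y \<in> V2 \<Longrightarrow> z \<in> V1" unfolding V1_def V2_def using ext even_Suc by blast
  qed
  have "bipartite_graph \<mu>"
    unfolding bipartite_graph_def
  proof (intro exI conjI allI impI)
    show "V1 \<union> V2 = UNIV" "V1 \<inter> V2 = {}" by (fact un disj)+
    show "y \<in> V1 \<and> z \<in> V2 \<or> y \<in> V2 \<and> z \<in> V1" if "adj \<mu> y z" for y z
      using step[OF that] un by auto
  qed
  with nb show False by contradiction
qed

lemma adj_iff_dist:
  assumes "connected_graph \<mu>" "x \<noteq> y"
  shows "adj \<mu> x y \<longleftrightarrow> graph_dist \<mu> x y = 1"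
proof
  assume "adj \<mu> x y"
  then show "graph_dist \<mu> x y = 1"
    unfolding graph_dist_def using assms(2)
    by (intro Least_equality) (auto simp: Suc_le_eq intro: gr0I)
next
  assume d: "graph_dist \<mu> x y = 1"
  have "\<exists>n. (adj \<mu> ^^ n) x y"
    using assms(1) by (simp add: connected_graph_def rtranclp_power)
  then have "(adj \<mu> ^^ graph_dist \<mu> x y) x y"
    unfolding graph_dist_def by (rule LeastI_ex)
  then show "adj \<mu> x y" unfolding d by auto
qed

text \<open>
  Distinct vertices are adjacent exactly when their distance is one, which isometries preserve;
  self-loops are preserved by the definition of \<open>graph_Aut\<close>.
\<close>

lemma Aut_adj:
  assumes "connected_graph \<mu>" "\<phi> \<in> graph_Aut \<mu>"
  shows "adj \<mu> (\<phi> x) (\<phi> y) \<longleftrightarrow> adj \<mu> x y"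
proof (cases "x = y")
  case False
  moreover have "bij \<phi>" "graph_dist \<mu> (\<phi> x) (\<phi> y) = graph_dist \<mu> x y"
    using assms(2) by (auto simp: graph_Aut_def self_isometry_def)
  ultimately show ?thesis
    using adj_iff_dist[OF assms(1)] by (metis bij_pointE)
qed (use assms(2) in \<open>simp add: graph_Aut_def\<close>)

lemma Aut_walk:
  assumes "connected_graph \<mu>" "\<phi> \<in> graph_Aut \<mu>"
  shows "(adj \<mu> ^^ n) x y \<Longrightarrow> (adj \<mu> ^^ n) (\<phi> x) (\<phi> y)"
proof (induction n arbitrary: y)
  case (Suc n)
  then obtain z where "(adj \<mu> ^^ n) x z" "adj \<mu> z y" by (meson relpowp_Suc_E)
  then show ?case
    using Suc.IH Aut_adj[OF assms] by (meson relpowp_Suc_I)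
qed simp

lemma Aut_neighbours:
  assumes "connected_graph \<mu>" "\<phi> \<in> graph_Aut \<mu>"
  shows "{y. adj \<mu> (\<phi> x) y} = \<phi> ` {y. adj \<mu> x y}"
proof -
  have "surj \<phi>"
    using assms(2) by (simp add: graph_Aut_def self_isometry_def bij_is_surj)
  then show ?thesis
    using Aut_adj[OF assms] by (auto simp: image_iff) (metis surjD)
qed

lemma orbit_representatives:
  assumes "quasi_transitive \<mu>"
  obtains F where "finite F" "\<forall>x. \<exists>y\<in>F. \<exists>\<phi>\<in>graph_Aut \<mu>. x = \<phi> y"
proof -
  obtain F where F: "finite F" "range (Aut_orbit \<mu>) = Aut_orbit \<mu> ` F"
    using assms finite_subset_image[of "range (Aut_orbit \<mu>)" "Aut_orbit \<mu>" UNIV]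
    unfolding quasi_transitive_def by blast
  have "\<exists>y\<in>F. \<exists>\<phi>\<in>graph_Aut \<mu>. x = \<phi> y" for x
  proof -
    have "id \<in> graph_Aut \<mu>" by (simp add: graph_Aut_def self_isometry_def)
    then have "x \<in> Aut_orbit \<mu> x" unfolding Aut_orbit_def by (metis id_apply image_eqI)
    moreover obtain y where "y \<in> F" "Aut_orbit \<mu> x = Aut_orbit \<mu> y" using F(2) by blast
    ultimately show ?thesis by (auto simp: Aut_orbit_def)
  qed
  with F(1) that show thesis by blast
qed

text \<open>
  A closed walk at an orbit representative is extended to a common length by going back and forth
  along an edge, and then moved to all other vertices by automorphisms.
\<close>

lemma common_odd_closed_walk:
  assumes \<mu>: "weighted_graph \<mu>" and con: "connected_graph \<mu>" and qt: "quasi_transitive \<mu>"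
    and nb: "\<not> bipartite_graph \<mu>" and nbr: "\<And>x. \<exists>y. adj \<mu> x y"
  obtains n where "odd n" "\<And>x. (adj \<mu> ^^ n) x x"
proof -
  obtain F where F: "finite F" "\<forall>x. \<exists>y\<in>F. \<exists>\<phi>\<in>graph_Aut \<mu>. x = \<phi> y"
    using orbit_representatives[OF qt] by blast
  obtain l where l: "\<And>y. odd (l y) \<and> (adj \<mu> ^^ l y) y y"
    using odd_closed_walk[OF \<mu> con nb] by metis
  \<comment> \<open>Any odd number that is at least every l y with y in F would do.\<close>
  define n where "n = 2 * sum l F + 1"
  have "(adj \<mu> ^^ n) x x" for x
  proof -
    obtain y \<phi> where y: "y \<in> F" "\<phi> \<in> graph_Aut \<mu>" "x = \<phi> y" using F(2) by blast
    have "l y \<le> n" using member_le_sum[OF y(1), of l] F(1) by (simp add: n_def)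
    moreover have "even (n - l y)" using l[of y] \<open>l y \<le> n\<close> by (simp add: n_def)
    ultimately obtain k where "n = l y + 2 * k" by (metis evenE le_add_diff_inverse)
    moreover obtain z where "adj \<mu> y z" using nbr by blast
    ultimately have "(adj \<mu> ^^ n) y y"
      using walk_append l even_closed_walk[OF \<mu>] by metis
    then show ?thesis using Aut_walk[OF con y(2)] y(3) by simp
  qed
  moreover have "odd n" by (simp add: n_def)
  ultimately show thesis using that by blast
qed

lemma degree_eq_card:
  assumes "unweighted \<mu>" "locally_finite_graph \<mu>"
  shows "degree \<mu> x = card {y. adj \<mu> x y}"
proof -
  have "degree \<mu> x = (\<Sum>\<^sub>\<infinity>y\<in>{y. adj \<mu> x y}. 1)"
    unfolding degree_def using assms(1)
    by (intro infsum_cong_neutral) (auto simp: unweighted_def)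
  then show ?thesis using assms(2) by (simp add: locally_finite_graph_def)
qed

lemma bounded_degree:
  assumes "unweighted \<mu>" "locally_finite_graph \<mu>" "connected_graph \<mu>" "quasi_transitive \<mu>"
  obtains D where "\<And>x. degree \<mu> x \<le> D"
proof -
  obtain F where F: "finite F" "\<forall>x. \<exists>y\<in>F. \<exists>\<phi>\<in>graph_Aut \<mu>. x = \<phi> y"
    using orbit_representatives[OF assms(4)] by blast
  have "degree \<mu> x \<le> Max (degree \<mu> ` F)" for x
  proof -
    obtain y \<phi> where y: "y \<in> F" "\<phi> \<in> graph_Aut \<mu>" "x = \<phi> y" using F(2) by blast
    then have "inj \<phi>" by (simp add: graph_Aut_def self_isometry_def bij_is_inj)
    then have "degree \<mu> x = degree \<mu> y"
      unfolding degree_eq_card[OF assms(1,2)] y(3) Aut_neighbours[OF assms(3) y(2)]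
      by (simp add: card_image inj_on_subset)
    then show ?thesis using F(1) y(1) by simp
  qed
  then show thesis by (rule that)
qed

section \<open>The random walk kernel\<close>

definition transition :: "('v \<Rightarrow> 'v \<Rightarrow> real) \<Rightarrow> 'v \<Rightarrow> 'v \<Rightarrow> real" where
  "transition \<mu> x y = \<mu> x y / degree \<mu> x"

lemma transition_support:
  assumes "weighted_graph \<mu>" "0 < degree \<mu> x"
  shows "{y. transition \<mu> x y \<noteq> 0} = {y. adj \<mu> x y}"
  using assms by (auto simp: transition_def adj_def weighted_graph_def less_le)

lemma kernel_op_transition:
  assumes "weighted_graph \<mu>" "locally_finite_graph \<mu>" "0 < degree \<mu> x"
  shows "kernel_op (transition \<mu>) f x = 1 / degree \<mu> x * (\<Sum>\<^sub>\<infinity>y. \<mu> x y * f y)"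
proof -
  have "(\<Sum>\<^sub>\<infinity>y. \<mu> x y * f y) = (\<Sum>\<^sub>\<infinity>y\<in>{y. adj \<mu> x y}. \<mu> x y * f y)"
    using assms(1) by (intro infsum_cong_neutral) (auto simp: adj_def weighted_graph_def less_le)
  also have "\<dots> = (\<Sum>y | adj \<mu> x y. \<mu> x y * f y)"
    using assms(2) by (simp add: locally_finite_graph_def)
  finally show ?thesis
    unfolding kernel_op_def transition_support[OF assms(1,3)]
    by (simp add: transition_def sum_divide_distrib)
qed

lemma reversible_transition:
  assumes "weighted_graph \<mu>" "locally_finite_graph \<mu>" "\<And>x. 0 < degree \<mu> x"
  shows "reversible_kernel (degree \<mu>) 1 (transition \<mu>)"
  unfolding reversible_kernel_def
proof (intro conjI allI)
  show "row_finite (transition \<mu>)"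
    using assms by (simp add: row_finite_def transition_support locally_finite_graph_def)
  show "0 \<le> transition \<mu> x y" for x y
    using assms(1) less_imp_le[OF assms(3)] by (simp add: transition_def weighted_graph_def)
  show "degree \<mu> x * transition \<mu> x y = degree \<mu> y * transition \<mu> y x" for x y
    using assms(1) assms(3)[of x] assms(3)[of y] by (simp add: transition_def weighted_graph_def)
  show "kernel_op (transition \<mu>) (\<lambda>y. 1) x = 1" for x
    using kernel_op_transition[OF assms(1,2) assms(3), of "\<lambda>y. 1" x] assms(3)[of x]
    by (simp flip: degree_def)
qed

text \<open>
  A single walk of \<open>n\<close> steps contributes at least \<open>\<delta> ^ n\<close>, and the other walks contribute
  nonnegative amounts.
\<close>

lemma kernel_power_walk:
  assumes p: "reversible_kernel d 1 p" and "0 \<le> \<delta>" and "\<And>x y. R x y \<Longrightarrow> \<delta> \<le> p x y"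
  shows "(R ^^ n) x y \<Longrightarrow> \<delta> ^ n \<le> kernel_power p n x y"
proof (induction n arbitrary: x)
  case 0
  then show ?case by auto
next
  case (Suc n)
  then obtain z where z: "R x z" "(R ^^ n) z y" by (meson relpowp_Suc_D2)
  have nonneg: "0 \<le> p x y" "0 \<le> kernel_power p n x y" "finite {y. p x y \<noteq> 0}" for x y
    using p reversible_power[OF p, of n] by (simp_all add: reversible_kernel_def row_finite_def)
  have "\<delta> * \<delta> ^ n \<le> p x z * kernel_power p n z y"
    using assms(2,3) z Suc.IH nonneg by (intro mult_mono) auto
  also have "\<dots> \<le> (\<Sum>w\<in>insert z {w. p x w \<noteq> 0}. p x w * kernel_power p n w y)"
    using nonneg by (intro member_le_sum[of z _ "\<lambda>w. p x w * kernel_power p n w y"]) auto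
  also have "\<dots> = kernel_power p (Suc n) x y"
    unfolding kernel_power.simps kernel_comp_def
    using nonneg by (intro kernel_op_superset[symmetric]) auto
  finally show ?case by simp
qed

theorem corollary9p1:
  fixes \<mu> :: "'v \<Rightarrow> 'v \<Rightarrow> real"
  assumes "weighted_graph \<mu>"
    and "unweighted \<mu>"
    and "infinite (UNIV :: 'v set)"
    and "locally_finite_graph \<mu>"
    and "connected_graph \<mu>"
    and "quasi_transitive \<mu>"
    and "top_of_spectrum \<mu> = 2"
  shows "bipartite_graph \<mu>"
proof (rule ccontr)
  assume nb: "\<not> bipartite_graph \<mu>"
  \<comment> \<open>In a connected graph with more than one vertex there are no isolated vertices.\<close>
  have nbr: "\<exists>y. adj \<mu> x y" for x
  proof -
    obtain y where "y \<noteq> x"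
      using assms(3) by (metis (full_types) UNIV_eq_I finite.emptyI finite_insert insertI1)
    moreover have "(adj \<mu>)\<^sup>*\<^sup>* x y"
      using assms(5) by (simp add: connected_graph_def)
    ultimately show ?thesis
      by (metis converse_rtranclpE)
  qed
  have d: "0 < degree \<mu> x" for x
    using nbr[of x] assms(4) unfolding degree_eq_card[OF assms(2,4)] locally_finite_graph_def
    by (simp add: card_gt_0_iff)
  obtain n where n: "odd n" "\<And>x. (adj \<mu> ^^ n) x x"
    using common_odd_closed_walk[OF assms(1,5,6) nb nbr] by blast
  obtain D where D: "\<And>x. degree \<mu> x \<le> D"
    using bounded_degree[OF assms(2,4,5,6)] by blast
  have D0: "0 < D" using d D by (meson less_le_trans)
  note p = reversible_transition[OF assms(1,4) d]
  define \<epsilon> where "\<epsilon> = (1 / D) ^ n"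
  have "1 / D \<le> transition \<mu> x y" if "adj \<mu> x y" for x y
    using that assms(2) d[of x] D[of x] by (simp add: transition_def unweighted_def frac_le)
  then have \<epsilon>: "\<epsilon> \<le> kernel_power (transition \<mu>) n x x" for x
    unfolding \<epsilon>_def using kernel_power_walk[OF p _ _ n(2)] D0 by simp
  have \<epsilon>0: "0 < \<epsilon>" using D0 by (simp add: \<epsilon>_def)
  have lap: "normalized_laplacian \<mu> f x = f x - kernel_op (transition \<mu>) f x" for f x
    unfolding normalized_laplacian_def kernel_op_transition[OF assms(1,4) d] by simp
  have "top_of_spectrum \<mu> \<le> ereal (2 - \<epsilon> / n)"
    unfolding top_of_spectrum_def
    using spectrum_gap[OF assms(1) d p lap n(1) \<epsilon>0 \<epsilon>] by (intro SUP_least) simp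
  moreover have "ereal (2 - \<epsilon> / n) < 2"
    using \<epsilon>0 odd_pos[OF n(1)] by simp
  ultimately show False using assms(7) by simp
qed

end
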